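(* Let $k\ge1$ and let $c_1,\dots,c_k$ be non-negative integers with $c_1=0$, $c_k>0$ and $\gcd\{m:c_m\ne0\}=1$ (a ZLRR), and let $P(x)=x^k-c_1x^{k-1}-\cdots-c_k$. Suppose the roots $r_1,\dots,r_k$ of $P(x)$ each have multiplicity $1$, where $r_1$ is the principal root and $r_2,\dots,r_k$ are the remaining roots. Run the Zeroing Algorithm on real inputs $\beta_1,\dots,\beta_k$ (not all zero) with $Q_0(x)=\beta_1x^{k-1}+\cdots+\beta_k$, and write the Binet expansion $q(1,t)=a_1r_1^t+a_2r_2^t+\cdots+a_kr_k^t$ ($t\ge0$). Then $$a_1=\frac{Q_0(r_1)}{\prod_{i=2}^{k}(r_1-r_i)}.$$
   Context: A root is principal if it is a positive root of multiplicity one whose magnitude is strictly greater than that of every other root; for $P$ as in the claim it exists and is unique. Zeroing Algorithm: starting from $Q_0(x)$, define for $t\ge1$ the polynomials $Q_t(x)=x\,Q_{t-1}(x)-q(1,t-1)P(x)$, where $q(n,t)$ denotes the coefficient of $x^{k-n}$ in $Q_t(x)$ for $1\le n\le k$ (each $Q_t$ has degree at most $k-1$). The sequence $(q(1,t))_{t\ge0}$ satisfies $q(1,t)=\sum_{i=1}^kc_iq(1,t-i)$ for $t\ge k$, so, $P$ having simple roots, it has a unique expansion of the form $\sum_i a_ir_i^t$. *)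

theory Defs
  imports Complex_Main "HOL-Computational_Algebra.Polynomial"
begin

definition is_ZLRR :: "nat \<Rightarrow> (nat \<Rightarrow> nat) \<Rightarrow> bool" where
  "is_ZLRR k c \<longleftrightarrow>
     k \<ge> 1 \<and> c 1 = 0 \<and> c k > 0 \<and> Gcd {m \<in> {1..k}. c m \<noteq> 0} = 1"

definition char_poly_rec :: "nat \<Rightarrow> (nat \<Rightarrow> nat) \<Rightarrow> real poly" where
  "char_poly_rec k c = monom 1 k - (\<Sum>i = 1..k. monom (real (c i)) (k - i))"

abbreviation cpoly :: "real poly \<Rightarrow> complex poly" where
  "cpoly p \<equiv> map_poly complex_of_real p"

definition principal_root :: "real poly \<Rightarrow> complex \<Rightarrow> bool" where
  "principal_root p z \<longleftrightarrow>
     z \<in> \<real> \<and> Re z > 0 \<and> poly (cpoly p) z = 0 \<and> order z (cpoly p) = 1 \<and>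
     (\<forall>w. poly (cpoly p) w = 0 \<and> w \<noteq> z \<longrightarrow> cmod w < cmod z)"

definition init_poly :: "nat \<Rightarrow> (nat \<Rightarrow> real) \<Rightarrow> real poly" where
  "init_poly k \<beta> = (\<Sum>i = 1..k. monom (\<beta> i) (k - i))"

text \<open>The factor \<open>coeff (zeroing k c \<beta> t) (k - 1)\<close> below is \<open>q(1, t)\<close>; see \<open>zcoeff\<close>.\<close>

primrec zeroing :: "nat \<Rightarrow> (nat \<Rightarrow> nat) \<Rightarrow> (nat \<Rightarrow> real) \<Rightarrow> nat \<Rightarrow> real poly" where
  "zeroing k c \<beta> 0 = init_poly k \<beta>"
| "zeroing k c \<beta> (Suc t) =
     monom 1 1 * zeroing k c \<beta> t
       - smult (coeff (zeroing k c \<beta> t) (k - 1)) (char_poly_rec k c)"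

text \<open>\<open>q(n, t)\<close>, meaningful for \<open>1 \<le> n \<le> k\<close>.\<close>

definition zcoeff :: "nat \<Rightarrow> (nat \<Rightarrow> nat) \<Rightarrow> (nat \<Rightarrow> real) \<Rightarrow> nat \<Rightarrow> nat \<Rightarrow> real" where
  "zcoeff k c \<beta> n t = coeff (zeroing k c \<beta> t) (k - n)"

end

theory Submission
  imports Defs "HOL-Computational_Algebra.Fundamental_Theorem_Algebra"
begin

text \<open>
  Write \<open>L\<^sub>i = \<Prod>\<^bsub>j \<noteq> i\<^esub> (x - r\<^sub>j)\<close>, so that \<open>(x - r\<^sub>i) L\<^sub>i = P\<close>, and let \<open>W\<^sub>t = \<Sum>\<^sub>i a\<^sub>i r\<^sub>i\<^sup>t L\<^sub>i\<close>.
  Then \<open>W\<^sub>t\<close> obeys the recursion of the Zeroing Algorithm, \<open>W\<^bsub>t+1\<^esub> = x W\<^sub>t - q(1,t) P\<close>, so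
  \<open>Q\<^sub>t - W\<^sub>t = x\<^sup>t (Q\<^sub>0 - W\<^sub>0)\<close>. The left-hand side has degree less than \<open>k\<close> for every \<open>t\<close>, which
  forces \<open>Q\<^sub>0 = W\<^sub>0\<close>; evaluating at \<open>r\<^sub>1\<close> kills every summand of \<open>W\<^sub>0\<close> except the first.
\<close>

lemma coeff_char_poly_rec_top: "coeff (char_poly_rec k c) k = 1"
proof -
  have "(\<Sum>i = 1..k. coeff (monom (real (c i)) (k - i)) k) = 0"
    by (rule sum.neutral) auto
  then show ?thesis
    by (simp add: char_poly_rec_def coeff_sum)
qed

lemma degree_char_poly_rec: "degree (char_poly_rec k c) = k"
proof (rule antisym)
  have "degree (monom (real (c i)) (k - i)) \<le> k" for i
    by (rule order.trans[OF degree_monom_le]) simp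
  then show "degree (char_poly_rec k c) \<le> k"
    unfolding char_poly_rec_def
    by (intro degree_diff_le[OF degree_monom_le] degree_sum_le) simp_all
qed (simp add: le_degree coeff_char_poly_rec_top)

lemma lead_coeff_char_poly_rec: "lead_coeff (char_poly_rec k c) = 1"
  by (simp add: degree_char_poly_rec coeff_char_poly_rec_top)

lemma degree_init_poly:
  assumes "k \<ge> 1"
  shows "degree (init_poly k \<beta>) < k"
proof -
  have "degree (monom (\<beta> i) (k - i)) \<le> k - 1" if "i \<in> {1..k}" for i
  proof -
    have "k - i \<le> k - 1"
      using that by auto
    with degree_monom_le show ?thesis
      by (rule order.trans)
  qed
  then have "degree (init_poly k \<beta>) \<le> k - 1"
    unfolding init_poly_def by (intro degree_sum_le) auto
  then show ?thesis
    using assms by simp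
qed

text \<open>Multiplying by \<open>x\<close> can create a term in \<open>x^k\<close>, with
  coefficient \<open>q(1,t)\<close>; since the characteristic polynomial is monic, subtracting
  \<open>q(1,t)\<close> times it removes exactly that term.\<close>

lemma degree_zeroing:
  assumes "k \<ge> 1"
  shows "degree (zeroing k c \<beta> t) < k"
proof (induction t)
  case 0
  then show ?case
    using degree_init_poly[OF assms] by simp
next
  case (Suc t)
  have "coeff (zeroing k c \<beta> (Suc t)) n = 0" if n: "n > k - 1" for n
  \<comment> \<open>Cancellation happens only at \<open>n = k\<close>. Beyond \<open>k\<close>, both
    polynomials have zero coefficients for degree reasons.\<close>
  proof (cases "n = k")
    case True
    then show ?thesis
      using assms by (simp add: coeff_monom_mult coeff_char_poly_rec_top)
  next
    case False
    with n have "n - 1 > degree (zeroing k c \<beta> t)" "n > degree (char_poly_rec k c)"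
      using Suc by (auto simp: degree_char_poly_rec)
    then show ?thesis
      by (simp add: coeff_monom_mult coeff_eq_0)
  qed
  then have "degree (zeroing k c \<beta> (Suc t)) \<le> k - 1"
    by (intro degree_le) blast
  then show ?case
    using assms by simp
qed

text \<open>Over the complex numbers a polynomial splits into linear factors; simplicity makes every
  exponent 1, and the bijection turns the product over roots into one over indices.\<close>

lemma monic_poly_eq_prod_roots:
  fixes p :: "complex poly"
  assumes "lead_coeff p = 1"
    and "\<And>z. poly p z = 0 \<Longrightarrow> order z p = 1"
    and "bij_betw r A {z. poly p z = 0}"
  shows "p = (\<Prod>i\<in>A. [:- r i, 1:])"
proof -
  have "p = (\<Prod>z | poly p z = 0. [:- z, 1:] ^ order z p)"
    using complex_poly_decompose[of p] assms(1) by simp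
  also have "\<dots> = (\<Prod>z | poly p z = 0. [:- z, 1:])"
    using assms(2) by (intro prod.cong) auto
  also have "\<dots> = (\<Prod>i\<in>A. [:- r i, 1:])"
    by (rule prod.reindex_bij_betw[OF assms(3), symmetric])
  finally show ?thesis .
qed

text \<open>Over a domain, each multiplication by \<open>x\<close> raises the degree of a nonzero
  polynomial by exactly one, so the bound would fail at \<open>t = k\<close>.\<close>

lemma eq_0_if_degree_orbit_bounded:
  fixes D :: "nat \<Rightarrow> 'a::idom poly"
  assumes "\<And>t. D (Suc t) = monom 1 1 * D t"
    and "\<And>t. degree (D t) < k"
  shows "D 0 = 0"
proof (rule ccontr)
  assume "D 0 \<noteq> 0"
  \<comment> \<open>Nonvanishing is part of the induction because degrees add only for nonzero
    factors.\<close>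
  have "D t \<noteq> 0 \<and> degree (D t) = t + degree (D 0)" for t
  proof (induction t)
    case (Suc t)
    then show ?case
      by (simp add: assms(1) degree_mult_eq degree_monom_eq)
  qed (use \<open>D 0 \<noteq> 0\<close> in simp)
  from this[of k] show False
    using assms(2)[of k] by simp
qed

lemma cpoly_zeroing_Suc:
  "cpoly (zeroing k c \<beta> (Suc t)) =
     monom 1 1 * cpoly (zeroing k c \<beta> t)
       - smult (complex_of_real (zcoeff k c \<beta> 1 t)) (cpoly (char_poly_rec k c))"
  by (rule poly_eqI) (simp add: coeff_map_poly coeff_monom_mult zcoeff_def)

lemma init_poly_eq_Lagrange_sum:
  fixes r a :: "nat \<Rightarrow> complex"
  assumes "k \<ge> 1"
    and fact: "cpoly (char_poly_rec k c) = (\<Prod>i\<in>{1..k}. [:- r i, 1:])"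
    and binet: "\<And>t. complex_of_real (zcoeff k c \<beta> 1 t) = (\<Sum>i = 1..k. a i * r i ^ t)"
  shows "cpoly (init_poly k \<beta>) =
    (\<Sum>i = 1..k. smult (a i) (\<Prod>j\<in>{1..k} - {i}. [:- r j, 1:]))"
proof -
  define L where "L i = (\<Prod>j\<in>{1..k} - {i}. [:- r j, 1:])" for i
  define W where "W t = (\<Sum>i = 1..k. smult (a i * r i ^ t) (L i))" for t
  define D where "D t = cpoly (zeroing k c \<beta> t) - W t" for t
  have L: "[:- r i, 1:] * L i = cpoly (char_poly_rec k c)" if "i \<in> {1..k}" for i
    unfolding L_def fact using that by (intro prod.remove[symmetric]) auto
  have W_Suc: "W (Suc t) = monom 1 1 * W t
    - smult (complex_of_real (zcoeff k c \<beta> 1 t)) (cpoly (char_poly_rec k c))" for t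
  proof -
    have "smult (a i * r i ^ Suc t) (L i) = monom 1 1 * smult (a i * r i ^ t) (L i)
        - smult (a i * r i ^ t) (cpoly (char_poly_rec k c))" if "i \<in> {1..k}" for i
    proof -
      \<comment> \<open>Modulo the characteristic polynomial, \<open>L i\<close> is an eigenvector
        of multiplication by \<open>x\<close>, with eigenvalue \<open>r i\<close>.\<close>
      have "monom 1 1 * L i - cpoly (char_poly_rec k c) = smult (r i) (L i)"
        using L[OF that, symmetric] by (simp add: monom_Suc monom_0)
      then have "smult (a i * r i ^ t) (monom 1 1 * L i - cpoly (char_poly_rec k c))
          = smult (a i * r i ^ t) (smult (r i) (L i))"
        by simp
      then show ?thesis
        by (simp add: smult_diff_right mult_ac)
    qed
    then show ?thesis
      \<comment> \<open>Summed over \<open>i\<close>, the multiples of the characteristic polynomial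
        have total coefficient \<open>q(1,t)\<close>, by the Binet expansion.\<close>
      unfolding W_def binet
      by (simp add: sum_subtractf sum_distrib_left smult_sum del: power_Suc)
  qed
  have "D (Suc t) = monom 1 1 * D t" for t
    unfolding D_def cpoly_zeroing_Suc W_Suc by (simp add: algebra_simps)
  moreover have "degree (D t) < k" for t
  proof -
    have "degree (L i) \<le> k - 1" if "i \<in> {1..k}" for i
      using that degree_prod_sum_le[of "{1..k} - {i}" "\<lambda>j. [:- r j, 1:]"]
      by (simp add: L_def)
    then have "degree (W t) \<le> k - 1"
      unfolding W_def by (intro degree_sum_le order.trans[OF degree_smult_le]) auto
    moreover have "degree (cpoly (zeroing k c \<beta> t)) \<le> k - 1"
      using degree_zeroing[OF assms(1), of c \<beta> t]
        by (simp add: degree_map_poly)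
    ultimately have "degree (D t) \<le> k - 1"
      unfolding D_def by (intro degree_diff_le)
    then show ?thesis
      using assms(1) by simp
  qed
  ultimately have "D 0 = 0"
    by (rule eq_0_if_degree_orbit_bounded)
  then show ?thesis
    by (simp add: D_def W_def L_def)
qed

theorem theorem4p5:
  fixes k :: nat and c :: "nat \<Rightarrow> nat" and r a :: "nat \<Rightarrow> complex" and \<beta> :: "nat \<Rightarrow> real"
  assumes "is_ZLRR k c"
    and "bij_betw r {1..k} {z. poly (cpoly (char_poly_rec k c)) z = 0}"
    and "\<forall>i\<in>{1..k}. order (r i) (cpoly (char_poly_rec k c)) = 1"
    and "principal_root (char_poly_rec k c) (r 1)"
    and "\<exists>i\<in>{1..k}. \<beta> i \<noteq> 0"
    and "\<forall>t. complex_of_real (zcoeff k c \<beta> 1 t) = (\<Sum>i = 1..k. a i * r i ^ t)"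
  shows "a 1 = poly (cpoly (init_poly k \<beta>)) (r 1) / (\<Prod>i = 2..k. (r 1 - r i))"
proof -
  have k: "k \<ge> 1"
    using assms(1) by (simp add: is_ZLRR_def)
  have inj: "inj_on r {1..k}"
    using assms(2) by (rule bij_betw_imp_inj_on)
  have "lead_coeff (cpoly (char_poly_rec k c)) = 1"
    using lead_coeff_char_poly_rec[of k c] by (simp add: degree_map_poly coeff_map_poly)
  moreover have "order z (cpoly (char_poly_rec k c)) = 1"
    if "poly (cpoly (char_poly_rec k c)) z = 0" for z
  proof -
    \<comment> \<open>Simplicity is assumed at each \<open>r i\<close>; surjectivity of
      \<open>r\<close> onto the root set carries it to every root.\<close>
    have "z \<in> r ` {1..k}"
      using that bij_betw_imp_surj_on[OF assms(2)] by simp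
    then show ?thesis
      using assms(3) by blast
  qed
  ultimately have fact: "cpoly (char_poly_rec k c) = (\<Prod>i\<in>{1..k}. [:- r i, 1:])"
    using assms(2) by (intro monic_poly_eq_prod_roots)
  have "poly (cpoly (init_poly k \<beta>)) (r 1)
      = (\<Sum>i = 1..k. a i * (\<Prod>j\<in>{1..k} - {i}. r 1 - r j))"
    using init_poly_eq_Lagrange_sum[OF k fact] assms(6) by (simp add: poly_sum poly_prod)
  \<comment> \<open>For \<open>i\<close> other than 1 the product contains the factor with
    \<open>j = 1\<close>, which is zero.\<close>
  also have "\<dots> = (\<Sum>i\<in>{1}. a i * (\<Prod>j\<in>{1..k} - {i}. r 1 - r j))"
    using k by (intro sum.mono_neutral_right) auto
  also have "\<dots> = a 1 * (\<Prod>i = 2..k. r 1 - r i)"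
  proof -
    have "{1..k} - {1} = {2..k}"
      by auto
    then show ?thesis
      by simp
  qed
  finally have "poly (cpoly (init_poly k \<beta>)) (r 1) = a 1 * (\<Prod>i = 2..k. r 1 - r i)" .
  \<comment> \<open>Distinct indices give distinct roots, so division by this product is
    legitimate.\<close>
  moreover have "(\<Prod>i = 2..k. r 1 - r i) \<noteq> 0"
    using inj_onD[OF inj, of 1] k by force
  ultimately show ?thesis
    by simp
qed

end
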